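(* For each pair of integers $n,m\ge 2$, the spaces $H_n$ and $H_m$ are $16$-bi-Lipschitz equivalent.
   Context: $\bigoplus_\omega\mathbb{Z}/n\mathbb{Z}$ is the group of sequences $(x_k)_{k\in\omega}$ in $\mathbb{Z}/n\mathbb{Z}$ with finitely many nonzero entries. For $h\in\mathbb{Z}/n\mathbb{Z}$, $h\ne0$, and $k\in\omega$, $h\cdot e_k$ is the sequence with $k$th coordinate $h$ and all others $0$. The infinite Hamming graph $H_n$ is the Cayley graph of $\bigoplus_\omega\mathbb{Z}/n\mathbb{Z}$ with respect to the generating set $\{h\cdot e_k: k\in\omega,\ h\in\mathbb{Z}/n\mathbb{Z}\setminus\{0\}\}$. One does not distinguish $H_n$ from its vertex set with the graph metric; this metric is the Hamming distance (the number of coordinates in which two sequences differ). Two metric spaces are $L$-bi-Lipschitz equivalent if there is a bijection $f$ between them with $\frac1L d(x,y)\le d(f(x),f(y))\le L\,d(x,y)$ for all $x,y$. *)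

theory Defs
  imports "HOL-Algebra.Product_Groups" "HOL-Analysis.Abstract_Metric_Spaces"
begin

definition cayley_graph :: "('a, 'b) monoid_scheme \<Rightarrow> 'a set \<Rightarrow> ('a \<times> 'a) set" where
  "cayley_graph G S = {(x, x \<otimes>\<^bsub>G\<^esub> s) | x s. x \<in> carrier G \<and> s \<in> S}"

text \<open>Length of a shortest walk from \<open>x\<close> to \<open>y\<close>. The value is unspecified if there is no walk,
  so this is only meaningful on connected graphs.\<close>

definition path_dist :: "('a \<times> 'a) set \<Rightarrow> 'a \<Rightarrow> 'a \<Rightarrow> nat" where
  "path_dist E x y = (LEAST k. (x, y) \<in> E ^^ k)"

text \<open>The graph metric on the vertex set \<open>V\<close>. The constructor \<^const>\<open>metric\<close> only behaves as
  intended on actual metric spaces; for the graphs used here this is \<open>Metric_space_hamming\<close>.\<close>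

definition graph_metric :: "'a set \<Rightarrow> ('a \<times> 'a) set \<Rightarrow> 'a metric" where
  "graph_metric V E = metric (V, \<lambda>x y. real (path_dist E x y))"

definition bilipschitz_equivalent :: "real \<Rightarrow> 'a metric \<Rightarrow> 'b metric \<Rightarrow> bool" where
  "bilipschitz_equivalent L X Y \<longleftrightarrow>
     (\<exists>f. bij_betw f (mspace X) (mspace Y) \<and>
          (\<forall>x\<in>mspace X. \<forall>y\<in>mspace X.
             1 / L * mdist X x y \<le> mdist Y (f x) (f y) \<and>
             mdist Y (f x) (f y) \<le> L * mdist X x y))"

definition hamming_group :: "nat \<Rightarrow> (nat \<Rightarrow> int) monoid" where
  "hamming_group n = sum_group UNIV (\<lambda>_. integer_mod_group n)"

definition hamming_gens :: "nat \<Rightarrow> (nat \<Rightarrow> int) set" where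
  "hamming_gens n = {(\<lambda>_. 0)(k := h) | k h. h \<in> carrier (integer_mod_group n) - {0}}"

definition hamming_edges :: "nat \<Rightarrow> ((nat \<Rightarrow> int) \<times> (nat \<Rightarrow> int)) set" where
  "hamming_edges n = cayley_graph (hamming_group n) (hamming_gens n)"

definition hamming_space :: "nat \<Rightarrow> (nat \<Rightarrow> int) metric" where
  "hamming_space n = graph_metric (carrier (hamming_group n)) (hamming_edges n)"

text \<open>The remaining lemmas show that \<^const>\<open>hamming_space\<close> is a genuine metric space with the
  expected points and distance.\<close>

lemma carrier_hamming_group:
  "carrier (hamming_group n) = {x. (\<forall>k. x k \<in> carrier (integer_mod_group n)) \<and> finite {k. x k \<noteq> 0}}"
  by (auto simp: hamming_group_def carrier_sum_group PiE_iff)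

lemma group_hamming_group: "group (hamming_group n)"
  by (simp add: hamming_group_def)

lemma mult_hamming_group:
  "x \<otimes>\<^bsub>hamming_group n\<^esub> y = (\<lambda>k. x k \<otimes>\<^bsub>integer_mod_group n\<^esub> y k)"
  by (simp add: hamming_group_def restrict_UNIV del: mult_integer_mod_group)

lemma hamming_gens_subset: "hamming_gens n \<subseteq> carrier (hamming_group n)"
  by (auto simp: hamming_gens_def carrier_hamming_group)

lemma hamming_edges_iff:
  "(x, y) \<in> hamming_edges n \<longleftrightarrow>
     x \<in> carrier (hamming_group n) \<and> y \<in> carrier (hamming_group n) \<and> (\<exists>k. {i. x i \<noteq> y i} = {k})"
proof -
  interpret Z: group "integer_mod_group n" by simp
  interpret H: group "hamming_group n" by (rule group_hamming_group)
  have unit: "a \<otimes>\<^bsub>integer_mod_group n\<^esub> 0 = a" if "a \<in> carrier (integer_mod_group n)" for a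
    using Z.r_one[OF that] by (simp only: one_integer_mod_group)
  show ?thesis
  proof
    assume "(x, y) \<in> hamming_edges n"
    then obtain k h where x: "x \<in> carrier (hamming_group n)"
      and h: "h \<in> carrier (integer_mod_group n)" "h \<noteq> 0"
      and y: "y = x \<otimes>\<^bsub>hamming_group n\<^esub> (\<lambda>_. 0)(k := h)"
      unfolding hamming_edges_def cayley_graph_def hamming_gens_def by blast
    have xc: "x i \<in> carrier (integer_mod_group n)" for i
      using x by (simp add: carrier_hamming_group)
    have "(\<lambda>_. 0)(k := h) \<in> carrier (hamming_group n)"
      using h hamming_gens_subset by (force simp: hamming_gens_def)
    then have yc: "y \<in> carrier (hamming_group n)"
      unfolding y using x by (rule H.m_closed[rotated])
    have "y i = x i" if "i \<noteq> k" for i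
      using that unit[OF xc] by (simp add: y mult_hamming_group del: mult_integer_mod_group)
    moreover have "y k \<noteq> x k"
    proof
      assume "y k = x k"
      then have "x k \<otimes>\<^bsub>integer_mod_group n\<^esub> h = x k"
        by (simp add: y mult_hamming_group del: mult_integer_mod_group)
      then have "h = \<one>\<^bsub>integer_mod_group n\<^esub>"
        using Z.l_cancel_one[OF xc h(1)] by blast
      with h show False by simp
    qed
    ultimately have "{i. x i \<noteq> y i} = {k}" by force
    with x yc show "x \<in> carrier (hamming_group n) \<and> y \<in> carrier (hamming_group n) \<and> (\<exists>k. {i. x i \<noteq> y i} = {k})"
      by blast
  next
    assume "x \<in> carrier (hamming_group n) \<and> y \<in> carrier (hamming_group n) \<and> (\<exists>k. {i. x i \<noteq> y i} = {k})"
    then obtain k where x: "x \<in> carrier (hamming_group n)" and y: "y \<in> carrier (hamming_group n)"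
      and k: "{i. x i \<noteq> y i} = {k}" by blast
    have xc: "x i \<in> carrier (integer_mod_group n)" and yc: "y i \<in> carrier (integer_mod_group n)" for i
      using x y by (simp_all add: carrier_hamming_group)
    define h where "h = inv\<^bsub>integer_mod_group n\<^esub> (x k) \<otimes>\<^bsub>integer_mod_group n\<^esub> y k"
    have hc: "h \<in> carrier (integer_mod_group n)"
      unfolding h_def by (intro Z.m_closed Z.inv_closed xc yc)
    have xh: "x k \<otimes>\<^bsub>integer_mod_group n\<^esub> h = y k"
      unfolding h_def
      by (metis Z.inv_closed Z.m_assoc Z.r_inv Z.l_one xc yc)
    have "h \<noteq> 0"
      using unit[OF xc] xh k by force
    moreover have "y = x \<otimes>\<^bsub>hamming_group n\<^esub> (\<lambda>_. 0)(k := h)"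
    proof
      fix i
      show "y i = (x \<otimes>\<^bsub>hamming_group n\<^esub> (\<lambda>_. 0)(k := h)) i"
        using xh unit[OF xc] k
        by (cases "i = k") (auto simp: mult_hamming_group simp del: mult_integer_mod_group)
    qed
    ultimately show "(x, y) \<in> hamming_edges n"
      using x hc unfolding hamming_edges_def cayley_graph_def hamming_gens_def by blast
  qed
qed

lemma sym_hamming_edges: "sym (hamming_edges n)"
proof (rule symI)
  fix x y
  assume "(x, y) \<in> hamming_edges n"
  moreover have "{i. y i \<noteq> x i} = {i. x i \<noteq> y i}" by auto
  ultimately show "(y, x) \<in> hamming_edges n" by (simp add: hamming_edges_iff)
qed

lemma finite_hamming_diff:
  assumes "x \<in> carrier (hamming_group n)" "y \<in> carrier (hamming_group n)"
  shows "finite {i. x i \<noteq> y i}"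
proof (rule finite_subset)
  show "{i. x i \<noteq> y i} \<subseteq> {i. x i \<noteq> 0} \<union> {i. y i \<noteq> 0}" by auto
qed (use assms in \<open>simp add: carrier_hamming_group\<close>)

lemma hamming_walk_lower:
  assumes "(x, y) \<in> hamming_edges n ^^ k"
  shows "finite {i. x i \<noteq> y i} \<and> card {i. x i \<noteq> y i} \<le> k"
  using assms
proof (induction k arbitrary: y)
  case 0
  then show ?case by simp
next
  case (Suc k)
  then obtain z where z: "(x, z) \<in> hamming_edges n ^^ k" "(z, y) \<in> hamming_edges n" by auto
  then obtain j where "{i. z i \<noteq> y i} = {j}" by (auto simp: hamming_edges_iff)
  then have sub: "{i. x i \<noteq> y i} \<subseteq> insert j {i. x i \<noteq> z i}" by force
  have fin: "finite {i. x i \<noteq> z i}" and "card {i. x i \<noteq> z i} \<le> k"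
    using Suc.IH[OF z(1)] by auto
  moreover from this have "card (insert j {i. x i \<noteq> z i}) \<le> Suc k"
    by (simp add: card_insert_if)
  ultimately show ?case
    using sub by (meson card_mono finite_insert finite_subset order_trans)
qed

lemma hamming_walk_exists:
  assumes "x \<in> carrier (hamming_group n)" "y \<in> carrier (hamming_group n)"
  shows "(x, y) \<in> hamming_edges n ^^ card {i. x i \<noteq> y i}"
  using assms
proof (induction "card {i. x i \<noteq> y i}" arbitrary: x)
  case 0
  then have "{i. x i \<noteq> y i} = {}" using finite_hamming_diff[of x n y] by simp
  then have "x = y" by auto
  then show ?case by simp
next
  case (Suc c)
  then obtain k where k: "x k \<noteq> y k"
    by (metis (mono_tags, lifting) card.empty empty_Collect_eq nat.distinct(1))
  let ?z = "x(k := y k)"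
  have "{i. ?z i \<noteq> 0} \<subseteq> insert k {i. x i \<noteq> 0}" by auto
  moreover have "finite {i. x i \<noteq> 0}"
    using Suc.prems(1) by (simp add: carrier_hamming_group)
  ultimately have "finite {i. ?z i \<noteq> 0}"
    by (meson finite_insert finite_subset)
  then have zc: "?z \<in> carrier (hamming_group n)"
    using Suc.prems unfolding carrier_hamming_group by simp
  have "{i. ?z i \<noteq> y i} = {i. x i \<noteq> y i} - {k}" by auto
  then have "card {i. ?z i \<noteq> y i} = c"
    using Suc.hyps(2)[symmetric] k by simp
  then have "(?z, y) \<in> hamming_edges n ^^ c"
    using Suc.hyps(1)[OF _ zc Suc.prems(2)] by metis
  moreover have "{i. x i \<noteq> ?z i} = {k}" using k by auto
  then have "(x, ?z) \<in> hamming_edges n"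
    unfolding hamming_edges_iff using zc Suc.prems(1) by blast
  ultimately have "(x, y) \<in> hamming_edges n ^^ Suc c" by (rule relpow_Suc_I2[rotated])
  then show ?case using Suc.hyps(2) by simp
qed

lemma path_dist_hamming:
  assumes "x \<in> carrier (hamming_group n)" "y \<in> carrier (hamming_group n)"
  shows "path_dist (hamming_edges n) x y = card {i. x i \<noteq> y i}"
  unfolding path_dist_def
proof (rule Least_equality)
  show "(x, y) \<in> hamming_edges n ^^ card {i. x i \<noteq> y i}"
    by (rule hamming_walk_exists[OF assms])
qed (rule hamming_walk_lower[THEN conjunct2])

lemma sym_relpow:
  assumes "sym E" "(x, y) \<in> E ^^ k"
  shows "(y, x) \<in> E ^^ k"
  using assms(2)
proof (induction k arbitrary: y)
  case (Suc k)
  then obtain z where "(x, z) \<in> E ^^ k" "(z, y) \<in> E" by auto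
  then have "(y, z) \<in> E" "(z, x) \<in> E ^^ k"
    using Suc.IH assms(1) by (auto dest: symD)
  then show ?case by (rule relpow_Suc_I2)
qed simp

lemma path_dist_commute:
  assumes "sym E"
  shows "path_dist E x y = path_dist E y x"
proof -
  have "(\<lambda>k. (x, y) \<in> E ^^ k) = (\<lambda>k. (y, x) \<in> E ^^ k)"
    using sym_relpow[OF assms] by blast
  then show ?thesis by (simp add: path_dist_def)
qed

lemma Metric_space_hamming:
  "Metric_space (carrier (hamming_group n)) (\<lambda>x y. real (path_dist (hamming_edges n) x y))"
proof
  fix x y
  show "real (path_dist (hamming_edges n) x y) = real (path_dist (hamming_edges n) y x)"
    by (simp add: path_dist_commute[OF sym_hamming_edges, of n x y])
next
  fix x y
  assume xy: "x \<in> carrier (hamming_group n)" "y \<in> carrier (hamming_group n)"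
  show "real (path_dist (hamming_edges n) x y) = 0 \<longleftrightarrow> x = y"
    using finite_hamming_diff[OF xy] by (auto simp: path_dist_hamming[OF xy])
next
  fix x y z
  assume xyz: "x \<in> carrier (hamming_group n)" "y \<in> carrier (hamming_group n)"
    "z \<in> carrier (hamming_group n)"
  have "{i. x i \<noteq> z i} \<subseteq> {i. x i \<noteq> y i} \<union> {i. y i \<noteq> z i}" by auto
  then have "card {i. x i \<noteq> z i} \<le> card ({i. x i \<noteq> y i} \<union> {i. y i \<noteq> z i})"
    using xyz by (intro card_mono) (auto intro: finite_hamming_diff)
  also have "\<dots> \<le> card {i. x i \<noteq> y i} + card {i. y i \<noteq> z i}" by (rule card_Un_le)
  finally show "real (path_dist (hamming_edges n) x z)
      \<le> real (path_dist (hamming_edges n) x y) + real (path_dist (hamming_edges n) y z)"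
    using xyz by (simp add: path_dist_hamming)
qed simp

lemma mspace_hamming_space: "mspace (hamming_space n) = carrier (hamming_group n)"
  by (simp add: hamming_space_def graph_metric_def Metric_space.mspace_metric[OF Metric_space_hamming])

lemma mdist_hamming_space:
  assumes "x \<in> carrier (hamming_group n)" "y \<in> carrier (hamming_group n)"
  shows "mdist (hamming_space n) x y = real (card {i. x i \<noteq> y i})"
  using assms
  by (simp add: hamming_space_def graph_metric_def Metric_space.mdist_metric[OF Metric_space_hamming]
      path_dist_hamming)

end

theory Submission
  imports Defs
begin

text \<open>It suffices to find a bijection \<open>H\<^sub>n \<times> H\<^sub>m \<rightarrow> H\<^sub>m\<close> (with the sum metric on the left) that is
  4-bi-Lipschitz: exchanging the roles of \<open>n\<close> and \<open>m\<close> gives \<open>H\<^sub>n \<times> H\<^sub>m \<rightarrow> H\<^sub>n\<close>, and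
  the constants multiply to 16. Cutting \<open>\<omega>\<close> into infinitely many infinite blocks, this reduces to
  one bijection \<open>\<int>/n \<times> H\<^sub>m \<rightarrow> H\<^sub>m\<close> fixing the origin. Colour \<open>x \<in> H\<^sub>m\<close> by the residue of
  \<open>\<Sum>i. i * x i\<close> modulo \<open>n\<close>. Putting a 1 at a suitable coordinate beyond the support of \<open>x\<close>
  injects \<open>H\<^sub>m\<close> into any prescribed colour class and moves points by 1 (the injection is undone by
  deleting the last nonzero entry), so by Schroeder and Bernstein each colour class is in bijection
  with all of \<open>H\<^sub>m\<close> by a map moving every point by at most 1.\<close>

section \<open>Schroeder-Bernstein bijections with control of each value\<close>

text \<open>Apply \<open>h\<close> on the forward orbits of \<open>B - A\<close> and the identity
  elsewhere. The second conclusion lets \<open>f\<close> inherit a displacement bound from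
  \<open>h\<close>; the third serves to keep the origin fixed.\<close>

lemma Schroeder_Bernstein_subset:
  assumes "A \<subseteq> B" and inj: "inj_on h B" and hB: "h ` B \<subseteq> A"
  obtains f where "bij_betw f B A" and "\<And>b. b \<in> B \<Longrightarrow> f b = b \<or> f b = h b"
    and "\<And>b. b \<in> A - h ` B \<Longrightarrow> f b = b"
proof -
  define D where "D = (\<Union>k. (h ^^ k) ` (B - A))"
  have DB: "D \<subseteq> B"
  proof -
    have "(h ^^ k) ` (B - A) \<subseteq> B" for k
      using assms by (induction k) auto
    then show ?thesis by (auto simp: D_def)
  qed
  have base: "B - A \<subseteq> D"
    unfolding D_def by (rule subset_trans[OF _ UN_upper[of 0]]) auto
  have step: "h b \<in> D" if b: "b \<in> D" for b
  proof -
    obtain k where "b \<in> (h ^^ k) ` (B - A)" using b unfolding D_def by blast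
    then have "h b \<in> (h ^^ Suc k) ` (B - A)" by auto
    then show ?thesis unfolding D_def by blast
  qed
  have inv: "b \<in> B - A \<or> b \<in> h ` D" if b: "b \<in> D" for b
  proof -
    obtain k where k: "b \<in> (h ^^ k) ` (B - A)" using b unfolding D_def by blast
    show ?thesis
    proof (cases k)
      case (Suc l)
      then have "b \<in> h ` ((h ^^ l) ` (B - A))" using k by (simp add: image_comp)
      then show ?thesis unfolding D_def by blast
    qed (use k in simp)
  qed
  define f where "f b = (if b \<in> D then h b else b)" for b
  \<comment> \<open>The two branches cannot collide: \<open>h\<close> maps \<open>D\<close> into
    \<open>D\<close>, and the identity branch stays outside.\<close>
  have "inj_on f B"
    using step inj by (auto simp: inj_on_def f_def)
  moreover have "f ` B = A"
  proof
    show "f ` B \<subseteq> A" using hB base by (auto simp: f_def)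
    show "A \<subseteq> f ` B"
    proof
      fix a assume a: "a \<in> A"
      show "a \<in> f ` B"
      proof (cases "a \<in> D")
        case True
        then obtain d where "d \<in> D" "a = h d" using inv a by blast
        then show ?thesis using DB by (auto simp: f_def)
      next
        case False
        then show ?thesis using a \<open>A \<subseteq> B\<close> by (auto simp: f_def image_iff)
      qed
    qed
  qed
  ultimately have "bij_betw f B A" by (simp add: bij_betw_def)
  moreover have "f b = b" if "b \<in> A - h ` B" for b
    using that inv[of b] DB by (auto simp: f_def)
  ultimately show thesis using that[of f] by (auto simp: f_def)
qed

section \<open>Hamming distance with values in the natural numbers\<close>

definition hdist :: "(nat \<Rightarrow> int) \<Rightarrow> (nat \<Rightarrow> int) \<Rightarrow> nat" where
  "hdist x y = card {i. x i \<noteq> y i}"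

lemma hdist_commute: "hdist x y = hdist y x"
  by (simp add: hdist_def eq_commute)

lemma hdist_refl [simp]: "hdist x x = 0"
  by (simp add: hdist_def)

lemma hdist_triangle:
  assumes "x \<in> carrier (hamming_group n)" "y \<in> carrier (hamming_group n)"
    "z \<in> carrier (hamming_group n)"
  shows "hdist x z \<le> hdist x y + hdist y z"
proof -
  have "{i. x i \<noteq> z i} \<subseteq> {i. x i \<noteq> y i} \<union> {i. y i \<noteq> z i}" by auto
  then have "hdist x z \<le> card ({i. x i \<noteq> y i} \<union> {i. y i \<noteq> z i})"
    unfolding hdist_def using assms by (intro card_mono) (auto intro: finite_hamming_diff)
  also have "\<dots> \<le> hdist x y + hdist y z" unfolding hdist_def by (rule card_Un_le)
  finally show ?thesis .
qed

lemma hdist_pos: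
  assumes "x \<in> carrier (hamming_group n)" "y \<in> carrier (hamming_group n)" "x \<noteq> y"
  shows "1 \<le> hdist x y"
proof -
  have "{i. x i \<noteq> y i} \<noteq> {}" using assms(3) by auto
  then show ?thesis
    using finite_hamming_diff[OF assms(1,2)] by (simp add: hdist_def Suc_le_eq card_gt_0_iff)
qed

lemma zero_in_hamming: "(\<lambda>_. 0) \<in> carrier (hamming_group n)"
  by (auto simp: carrier_hamming_group)

section \<open>Colour classes of H_m and bijections onto them\<close>

text \<open>With the weights \<open>i\<close>, a new entry 1 at position \<open>k\<close> adds
  \<open>k\<close> to the sum, so the position alone can produce any residue modulo
  \<open>n\<close>, whatever the modulus of the entries.\<close>

definition colour :: "nat \<Rightarrow> (nat \<Rightarrow> int) \<Rightarrow> int" where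
  "colour n x = (\<Sum>i | x i \<noteq> 0. int i * x i) mod int n"

lemma append_one:
  assumes m: "m \<ge> 2" and n: "n \<ge> 2" and x: "x \<in> carrier (hamming_group m)"
    and a: "a \<in> carrier (integer_mod_group n)"
  shows "\<exists>k. (\<forall>i\<ge>k. x i = 0) \<and> x(k := 1) \<in> carrier (hamming_group m) \<and> colour n (x(k := 1)) = a"
proof -
  have fin: "finite {i. x i \<noteq> 0}" using x by (simp add: carrier_hamming_group)
  obtain N where N: "\<forall>i\<in>{i. x i \<noteq> 0}. i < N"
    using finite_nat_set_iff_bounded fin by blast
  define S where "S = (\<Sum>i | x i \<noteq> 0. int i * x i)"
  \<comment> \<open>The summand \<open>n * N\<close> moves \<open>k\<close> past the support without
    changing its residue, which is the one missing from \<open>S\<close>.\<close>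
  define k where "k = n * N + nat ((a - S) mod int n)"
  have "N \<le> n * N" using n by simp
  then have "N \<le> k" unfolding k_def by (rule trans_le_add1)
  then have zero: "x i = 0" if "i \<ge> k" for i
    using that N by fastforce
  have supp: "{i. (x(k := 1)) i \<noteq> 0} = insert k {i. x i \<noteq> 0}" by auto
  have "(\<Sum>i | (x(k := 1)) i \<noteq> 0. int i * (x(k := 1)) i)
      = int k + (\<Sum>i | x i \<noteq> 0. int i * (x(k := 1)) i)"
    unfolding supp using fin zero[of k] by (subst sum.insert) auto
  also have "(\<Sum>i | x i \<noteq> 0. int i * (x(k := 1)) i) = S"
    unfolding S_def using zero[of k] by (intro sum.cong) auto
  finally have "colour n (x(k := 1)) = (int k + S) mod int n" by (simp add: colour_def)
  also have "int k = int n * int N + (a - S) mod int n" using n by (simp add: k_def)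
  also have "(int n * int N + (a - S) mod int n + S) mod int n = a mod int n"
    by (simp add: mod_simps add.assoc)
  also have "\<dots> = a" using a n by (simp add: carrier_integer_mod_group)
  finally have "colour n (x(k := 1)) = a" .
  moreover have "x(k := 1) \<in> carrier (hamming_group m)"
    using x m supp fin unfolding carrier_hamming_group
    by (auto simp: carrier_integer_mod_group)
  ultimately show ?thesis using zero by blast
qed

lemma colour_class_bij:
  assumes m: "m \<ge> 2" and n: "n \<ge> 2" and a: "a \<in> carrier (integer_mod_group n)"
  shows "\<exists>f. bij_betw f (carrier (hamming_group m)) {x \<in> carrier (hamming_group m). colour n x = a}
    \<and> (\<forall>x\<in>carrier (hamming_group m). hdist x (f x) \<le> 1) \<and> (a = 0 \<longrightarrow> f (\<lambda>_. 0) = (\<lambda>_. 0))"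
proof -
  let ?V = "carrier (hamming_group m)" and ?A = "{x \<in> carrier (hamming_group m). colour n x = a}"
  obtain k where k: "\<And>x. x \<in> ?V \<Longrightarrow> (\<forall>i\<ge>k x. x i = 0) \<and> x(k x := 1) \<in> ?V \<and> colour n (x(k x := 1)) = a"
    using append_one[OF m n _ a] by metis
  define h where "h x = x(k x := (1::int))" for x
  have inj: "inj_on h ?V"
  proof (rule inj_onI)
    fix x y assume xy: "x \<in> ?V" "y \<in> ?V" "h x = h y"
    \<comment> \<open>The last nonzero entry of \<open>h x\<close> sits at \<open>k x\<close>, so
      \<open>h x\<close> determines \<open>k x\<close>.\<close>
    have *: "k x \<le> k y" if "x \<in> ?V" "y \<in> ?V" "h x = h y" for x y
    proof (rule ccontr)
      assume "\<not> k x \<le> k y"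
      then have "h y (k x) = 0" using k[OF that(2)] by (simp add: h_def)
      moreover have "h x (k x) = 1" by (simp add: h_def)
      ultimately show False using that(3) by simp
    qed
    then have keq: "k x = k y" using xy by (metis antisym)
    show "x = y"
    proof
      fix i
      show "x i = y i"
        using fun_cong[OF xy(3), of i] k[OF xy(1)] k[OF xy(2)] keq
        by (cases "i = k x") (auto simp: h_def)
    qed
  qed
  have hA: "h ` ?V \<subseteq> ?A" using k by (auto simp: h_def)
  obtain f where f: "bij_betw f ?V ?A" "\<And>b. b \<in> ?V \<Longrightarrow> f b = b \<or> f b = h b"
    and f0: "\<And>b. b \<in> ?A - h ` ?V \<Longrightarrow> f b = b"
    using Schroeder_Bernstein_subset[OF _ inj hA] by blast
  have "hdist x (h x) \<le> 1" for x
  proof -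
    have "{i. x i \<noteq> h x i} \<subseteq> {k x}" by (auto simp: h_def)
    then show ?thesis using card_mono[of "{k x}"] by (simp add: hdist_def)
  qed
  then have "\<forall>x\<in>?V. hdist x (f x) \<le> 1" using f(2) by fastforce
  moreover have "f (\<lambda>_. 0) = (\<lambda>_. 0)" if "a = 0"
  proof (rule f0)
    \<comment> \<open>The origin has colour 0 but is never a value of \<open>h\<close>, so the
      fixed-point clause of the Schroeder-Bernstein lemma applies to it.\<close>
    have "h x \<noteq> (\<lambda>_. 0)" for x
      by (metis fun_upd_same h_def zero_neq_one)
    then have "(\<lambda>_. 0) \<notin> h ` ?V" by force
    then show "(\<lambda>_. 0) \<in> ?A - h ` ?V"
      using that zero_in_hamming by (simp add: colour_def)
  qed
  ultimately show ?thesis using f(1) by blast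
qed

section \<open>Cutting the index set into infinitely many infinite blocks\<close>

definition block :: "(nat \<Rightarrow> int) \<Rightarrow> nat \<Rightarrow> nat \<Rightarrow> int" where
  "block x j i = x (prod_encode (j, i))"

definition unblock :: "(nat \<Rightarrow> nat \<Rightarrow> int) \<Rightarrow> nat \<Rightarrow> int" where
  "unblock z k = (case prod_decode k of (j, i) \<Rightarrow> z j i)"

lemma block_unblock [simp]: "block (unblock z) = z"
  by (simp add: block_def unblock_def fun_eq_iff)

lemma unblock_block [simp]: "unblock (block x) = x"
proof
  fix k
  show "unblock (block x) k = x k"
    by (cases "prod_decode k") (simp add: block_def unblock_def, metis prod_decode_inverse)
qed

lemma diff_eq_blocks:
  "{k. x k \<noteq> y k} = prod_encode ` (SIGMA j:{j. block x j \<noteq> block y j}. {i. block x j i \<noteq> block y j i})"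
proof
  show "{k. x k \<noteq> y k} \<subseteq> prod_encode ` (SIGMA j:{j. block x j \<noteq> block y j}. {i. block x j i \<noteq> block y j i})"
  proof
    fix k assume k: "k \<in> {k. x k \<noteq> y k}"
    obtain j i where "k = prod_encode (j, i)" by (metis prod_decode_inverse surj_pair)
    then show "k \<in> prod_encode ` (SIGMA j:{j. block x j \<noteq> block y j}. {i. block x j i \<noteq> block y j i})"
      using k by (auto simp: block_def fun_eq_iff)
  qed
qed (auto simp: block_def)

lemma finite_diff_iff_blocks:
  "finite {k. x k \<noteq> y k} \<longleftrightarrow>
     finite {j. block x j \<noteq> block y j} \<and> (\<forall>j. finite {i. block x j i \<noteq> block y j i})"
proof -
  let ?S = "SIGMA j:{j. block x j \<noteq> block y j}. {i. block x j i \<noteq> block y j i}"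
  have "finite {k. x k \<noteq> y k} \<longleftrightarrow> finite ?S"
    unfolding diff_eq_blocks[of x y] by (rule finite_image_iff) (simp add: inj_prod_encode)
  also have "\<dots> \<longleftrightarrow> finite {j. block x j \<noteq> block y j} \<and> (\<forall>j. finite {i. block x j i \<noteq> block y j i})"
  proof
    assume fin: "finite ?S"
    \<comment> \<open>Every block listed in the base differs somewhere, so its fibre is nonempty and
      the projection recovers the base.\<close>
    have "{j. block x j \<noteq> block y j} \<subseteq> fst ` ?S" by force
    then have 1: "finite {j. block x j \<noteq> block y j}" by (rule finite_subset) (rule finite_imageI[OF fin])
    have "{i. block x j i \<noteq> block y j i} \<subseteq> snd ` ?S" for j by force
    then have "finite {i. block x j i \<noteq> block y j i}" for j
      by (rule finite_subset) (rule finite_imageI[OF fin])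
    with 1 show "finite {j. block x j \<noteq> block y j} \<and> (\<forall>j. finite {i. block x j i \<noteq> block y j i})"
      by blast
  qed auto
  finally show ?thesis .
qed

text \<open>Identifies H_m with the finitely supported sequences of points of H_m, by comparing
  \<open>x\<close> with the origin.\<close>

lemma hamming_iff_blocks:
  "x \<in> carrier (hamming_group m) \<longleftrightarrow>
     (\<forall>j. block x j \<in> carrier (hamming_group m)) \<and> finite {j. block x j \<noteq> (\<lambda>_. 0)}"
proof -
  have 0: "block (\<lambda>_. 0) = (\<lambda>_ _. 0)" by (simp add: block_def fun_eq_iff)
  have "(\<forall>k. x k \<in> C) \<longleftrightarrow> (\<forall>j i. block x j i \<in> C)" for C
    by (metis block_def prod_decode_inverse surj_pair)
  then show ?thesis
    using finite_diff_iff_blocks[of x "\<lambda>_. 0"] unfolding carrier_hamming_group 0 by auto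
qed

text \<open>Blocks that agree contribute 0, so \<open>J\<close> may be larger than the set of
  differing blocks. This allows one \<open>J\<close> for several distances at once.\<close>

lemma hdist_eq_sum_blocks:
  assumes "x \<in> carrier (hamming_group m)" "y \<in> carrier (hamming_group m)"
    and "finite J" "\<And>j. j \<notin> J \<Longrightarrow> block x j = block y j"
  shows "hdist x y = (\<Sum>j\<in>J. hdist (block x j) (block y j))"
proof -
  let ?J = "{j. block x j \<noteq> block y j}"
  have fin: "finite ?J" "\<forall>j. finite {i. block x j i \<noteq> block y j i}"
    using finite_hamming_diff[OF assms(1,2)] unfolding finite_diff_iff_blocks[of x y] by simp_all
  have "hdist x y = card (SIGMA j:?J. {i. block x j i \<noteq> block y j i})"
    unfolding hdist_def diff_eq_blocks[of x y] by (rule card_image) (simp add: inj_prod_encode)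
  also have "\<dots> = (\<Sum>j\<in>?J. hdist (block x j) (block y j))"
    using fin by (simp add: hdist_def)
  also have "\<dots> = (\<Sum>j\<in>J. hdist (block x j) (block y j))"
    using assms(3,4) by (intro sum.mono_neutral_left) auto
  finally show ?thesis .
qed

text \<open>Each summand is the distance in one copy of Z/n; the form matches the block sums so that
  both add termwise.\<close>

lemma hdist_eq_sum_of_bool:
  assumes "finite J" "\<And>j. j \<notin> J \<Longrightarrow> a j = b j"
  shows "hdist a b = (\<Sum>j\<in>J. of_bool (a j \<noteq> b j))"
proof -
  have "{j. a j \<noteq> b j} = {j \<in> J. a j \<noteq> b j}" using assms(2) by auto
  then show ?thesis using assms(1) by (simp add: hdist_def sum.If_cases of_bool_def Int_def)
qed

section \<open>Absorbing a factor H_n into H_m\<close>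

text \<open>In block \<open>j\<close>, the coordinate \<open>a j\<close> is stored as the colour of
  a point at distance at most 1 from \<open>block y j\<close>. Since the colour classes partition
  H_m, this is bijective, and the distance bounds add up over the blocks.\<close>

lemma absorb_factor:
  assumes m: "m \<ge> 2" and n: "n \<ge> 2"
  obtains P where
    "bij_betw P (carrier (hamming_group n) \<times> carrier (hamming_group m)) (carrier (hamming_group m))"
    "\<And>a y b z. \<lbrakk>a \<in> carrier (hamming_group n); b \<in> carrier (hamming_group n);
        y \<in> carrier (hamming_group m); z \<in> carrier (hamming_group m)\<rbrakk> \<Longrightarrow>
        hdist (P (a, y)) (P (b, z)) \<le> 4 * (hdist a b + hdist y z) \<and>
        hdist a b + hdist y z \<le> 4 * hdist (P (a, y)) (P (b, z))"
proof -
  let ?U = "carrier (hamming_group n)" and ?V = "carrier (hamming_group m)"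
    and ?C = "carrier (integer_mod_group n)"
  obtain f where bij: "\<And>a. a \<in> ?C \<Longrightarrow> bij_betw (f a) ?V {x \<in> ?V. colour n x = a}"
    and near: "\<And>a x. a \<in> ?C \<Longrightarrow> x \<in> ?V \<Longrightarrow> hdist x (f a x) \<le> 1"
    and f0: "f 0 (\<lambda>_. 0) = (\<lambda>_. 0)"
  proof -
    have "\<exists>f. \<forall>a\<in>?C. bij_betw (f a) ?V {x \<in> ?V. colour n x = a} \<and>
        (\<forall>x\<in>?V. hdist x (f a x) \<le> 1) \<and> (a = 0 \<longrightarrow> f a (\<lambda>_. 0) = (\<lambda>_. 0))"
      by (rule bchoice) (use colour_class_bij[OF m n] in blast)
    then obtain f where f: "\<forall>a\<in>?C. bij_betw (f a) ?V {x \<in> ?V. colour n x = a} \<and>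
        (\<forall>x\<in>?V. hdist x (f a x) \<le> 1) \<and> (a = 0 \<longrightarrow> f a (\<lambda>_. 0) = (\<lambda>_. 0))" ..
    have "0 \<in> ?C" by (simp add: carrier_integer_mod_group)
    then show thesis using f by (intro that[of f]) blast+
  qed
  have fV: "f a x \<in> ?V" and col: "colour n (f a x) = a" if "a \<in> ?C" "x \<in> ?V" for a x
    using bij_betwE[OF bij[OF that(1)]] that by auto
  have finj: "a = b \<and> x = y"
    if "f a x = f b y" "a \<in> ?C" "b \<in> ?C" "x \<in> ?V" "y \<in> ?V" for a b x y
  proof -
    have "a = b" using col that by metis
    then show ?thesis using that bij_betw_imp_inj_on[OF bij] by (metis inj_onD)
  qed
  define P where "P = (\<lambda>(a, y). unblock (\<lambda>j. f (a j) (block y j)))"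
  have blockP: "block (P (a, y)) j = f (a j) (block y j)" for a y j
    by (simp add: P_def)
  have aC: "a j \<in> ?C" if "a \<in> ?U" for a j using that by (simp add: carrier_hamming_group)
  have bV: "block y j \<in> ?V" if "y \<in> ?V" for y j using that hamming_iff_blocks by blast
  have PV: "P (a, y) \<in> ?V" if "a \<in> ?U" "y \<in> ?V" for a y
  proof -
    \<comment> \<open>Since \<open>f 0\<close> fixes the origin, almost all blocks stay
      zero.\<close>
    have "{j. block (P (a, y)) j \<noteq> (\<lambda>_. 0)} \<subseteq> {j. a j \<noteq> 0} \<union> {j. block y j \<noteq> (\<lambda>_. 0)}"
      using f0 by (auto simp: blockP)
    moreover have "finite {j. a j \<noteq> 0}" "finite {j. block y j \<noteq> (\<lambda>_. 0)}"
      using that(1) that(2)[unfolded hamming_iff_blocks[of y]] by (simp_all add: carrier_hamming_group)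
    ultimately have "finite {j. block (P (a, y)) j \<noteq> (\<lambda>_. 0)}"
      by (meson finite_UnI finite_subset)
    then show ?thesis
      unfolding hamming_iff_blocks[of "P (a, y)"] using fV aC bV that by (simp add: blockP)
  qed
  have "inj_on P (?U \<times> ?V)"
  proof (rule inj_onI, clarify)
    fix a y b z assume *: "a \<in> ?U" "y \<in> ?V" "b \<in> ?U" "z \<in> ?V" "P (a, y) = P (b, z)"
    have "a j = b j \<and> block y j = block z j" for j
      by (rule finj) (use * aC bV in \<open>simp_all flip: blockP\<close>)
    then have "a = b" "block y = block z" by auto
    then show "a = b \<and> y = z" by (metis unblock_block)
  qed
  moreover have "P ` (?U \<times> ?V) = ?V"
  proof
    show "P ` (?U \<times> ?V) \<subseteq> ?V" using PV by auto
    show "?V \<subseteq> P ` (?U \<times> ?V)"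
    proof
      fix x assume x: "x \<in> ?V"
      \<comment> \<open>The H_n component of the preimage is read off from the colours of the
        blocks.\<close>
      define a where "a j = colour n (block x j)" for j
      have aC': "a j \<in> ?C" for j
        using n by (simp add: a_def colour_def carrier_integer_mod_group)
      have "\<exists>w\<in>?V. f (a j) w = block x j" for j
        using bij[OF aC'[of j]] bV[OF x, of j] unfolding bij_betw_def a_def
        by (metis (mono_tags, lifting) imageE mem_Collect_eq)
      then obtain w where w: "\<And>j. w j \<in> ?V" "\<And>j. f (a j) (w j) = block x j" by metis
      have fin: "finite {j. block x j \<noteq> (\<lambda>_. 0)}" using x hamming_iff_blocks by blast
      have a0: "a j = 0" if "block x j = (\<lambda>_. 0)" for j
        using that by (simp add: a_def colour_def)
      \<comment> \<open>A zero block has colour 0 and is the image of the origin under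
        \<open>f 0\<close>; injectivity then makes the preimage finitely supported.\<close>
      have w0: "w j = (\<lambda>_. 0)" if "block x j = (\<lambda>_. 0)" for j
        using finj[of "a j" "w j" 0 "\<lambda>_. 0"] that w f0 aC' zero_in_hamming by simp
      have "{j. a j \<noteq> 0} \<subseteq> {j. block x j \<noteq> (\<lambda>_. 0)}"
        and "{j. w j \<noteq> (\<lambda>_. 0)} \<subseteq> {j. block x j \<noteq> (\<lambda>_. 0)}"
        using a0 w0 by auto
      then have "finite {j. a j \<noteq> 0}" "finite {j. w j \<noteq> (\<lambda>_. 0)}"
        using fin finite_subset by blast+
      then have "a \<in> ?U" "unblock w \<in> ?V"
        using aC' w(1) hamming_iff_blocks[of "unblock w"] by (simp_all add: carrier_hamming_group)
      moreover have "P (a, unblock w) = x"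
        by (simp add: P_def w(2))
      ultimately show "x \<in> P ` (?U \<times> ?V)" by (metis SigmaI imageI)
    qed
  qed
  ultimately have "bij_betw P (?U \<times> ?V) ?V" by (simp add: bij_betw_def)
  moreover have "hdist (P (a, y)) (P (b, z)) \<le> 4 * (hdist a b + hdist y z) \<and>
        hdist a b + hdist y z \<le> 4 * hdist (P (a, y)) (P (b, z))"
    if V: "a \<in> ?U" "b \<in> ?U" "y \<in> ?V" "z \<in> ?V" for a y b z
  proof -
    define J where "J = {j. a j \<noteq> b j} \<union> {j. block y j \<noteq> block z j}"
    have J: "finite J"
      using finite_hamming_diff[OF V(1,2)] finite_hamming_diff[OF V(3,4)]
      by (simp add: J_def finite_diff_iff_blocks[of y z])
    have off: "a j = b j" "block y j = block z j" if "j \<notin> J" for j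
      using that by (auto simp: J_def)
    let ?s = "\<lambda>j. of_bool (a j \<noteq> b j) + hdist (block y j) (block z j)"
    let ?t = "\<lambda>j. hdist (f (a j) (block y j)) (f (b j) (block z j))"
    have "hdist a b = (\<Sum>j\<in>J. of_bool (a j \<noteq> b j))"
      by (rule hdist_eq_sum_of_bool[OF J]) (rule off)
    moreover have "hdist y z = (\<Sum>j\<in>J. hdist (block y j) (block z j))"
      by (rule hdist_eq_sum_blocks[OF V(3,4) J]) (rule off)
    ultimately have s: "hdist a b + hdist y z = (\<Sum>j\<in>J. ?s j)"
      by (simp only: sum.distrib)
    have t: "hdist (P (a, y)) (P (b, z)) = (\<Sum>j\<in>J. ?t j)"
      by (subst hdist_eq_sum_blocks[OF PV[OF V(1,3)] PV[OF V(2,4)] J]) (simp_all add: blockP off)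
    \<comment> \<open>The constant 4 arises here: \<open>c + d \<le> t + 3 \<le> 4 * t\<close>. The
      additive errors are absorbed because distinct points have distance at least 1.\<close>
    have arith: "t \<le> 4 * (c + d) \<and> c + d \<le> 4 * t"
      if "d \<le> t + 2" "t \<le> d + 2" "1 \<le> t" "1 \<le> c + d" "c \<le> 1" for c d t :: nat
      using that by auto
    have "?t j \<le> 4 * ?s j \<and> ?s j \<le> 4 * ?t j" for j
    proof -
      let ?u = "block y j" and ?v = "block z j"
      let ?u' = "f (a j) ?u" and ?v' = "f (b j) ?v"
      note uv = bV[OF V(3), of j] bV[OF V(4), of j]
      note uv' = fV[OF aC[OF V(1)] uv(1), of j] fV[OF aC[OF V(2)] uv(2), of j]
      show ?thesis
      \<comment> \<open>If both data agree, both sides vanish; otherwise both are at least 1, as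
        \<open>arith\<close> requires.\<close>
      proof (cases "a j = b j \<and> ?u = ?v")
        case False
        have "?u' \<noteq> ?v'" using finj False V aC uv by blast
        then have pos: "1 \<le> hdist ?u' ?v'" using hdist_pos uv' by blast
        have pos': "1 \<le> ?s j" using False hdist_pos[OF uv] by (cases "a j = b j") auto
        have nu: "hdist ?u ?u' \<le> 1" and nv: "hdist ?v ?v' \<le> 1"
          using near V aC uv by blast+
        have "hdist ?u ?v \<le> hdist ?u ?u' + (hdist ?u' ?v' + hdist ?v' ?v)"
          using hdist_triangle[OF uv(1) uv'(1) uv(2)] hdist_triangle[OF uv' uv(2)] by linarith
        then have 1: "hdist ?u ?v \<le> hdist ?u' ?v' + 2"
          using nu nv hdist_commute[of ?v ?v'] by linarith
        have "hdist ?u' ?v' \<le> hdist ?u' ?u + (hdist ?u ?v + hdist ?v ?v')"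
          using hdist_triangle[OF uv'(1) uv(1) uv'(2)] hdist_triangle[OF uv uv'(2)] by linarith
        then have 2: "hdist ?u' ?v' \<le> hdist ?u ?v + 2"
          using nu nv hdist_commute[of ?u ?u'] by linarith
        have bool: "of_bool (a j \<noteq> b j) \<le> (1::nat)" by simp
        show ?thesis
          by (rule arith[OF 1 2 pos pos' bool])
      qed auto
    qed
    then show ?thesis unfolding s t sum_distrib_left by (meson sum_mono)
  qed
  ultimately show thesis using that by blast
qed

section \<open>Bi-Lipschitz equivalence of H_n and H_m\<close>

theorem theorem4p8:
  fixes n m :: nat
  assumes "n \<ge> 2" and "m \<ge> 2"
  shows "bilipschitz_equivalent 16 (hamming_space n) (hamming_space m)"
proof -
  let ?U = "carrier (hamming_group n)" and ?V = "carrier (hamming_group m)"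
  obtain P where P: "bij_betw P (?U \<times> ?V) ?V"
    and Pd: "\<And>a y b z. \<lbrakk>a \<in> ?U; b \<in> ?U; y \<in> ?V; z \<in> ?V\<rbrakk> \<Longrightarrow>
        hdist (P (a, y)) (P (b, z)) \<le> 4 * (hdist a b + hdist y z) \<and>
        hdist a b + hdist y z \<le> 4 * hdist (P (a, y)) (P (b, z))"
    using absorb_factor[OF assms(2,1)] by blast
  obtain Q where Q: "bij_betw Q (?V \<times> ?U) ?U"
    and Qd: "\<And>a y b z. \<lbrakk>a \<in> ?V; b \<in> ?V; y \<in> ?U; z \<in> ?U\<rbrakk> \<Longrightarrow>
        hdist (Q (a, y)) (Q (b, z)) \<le> 4 * (hdist a b + hdist y z) \<and>
        hdist a b + hdist y z \<le> 4 * hdist (Q (a, y)) (Q (b, z))"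
    using absorb_factor[OF assms] by blast
  define R where "R = inv_into (?V \<times> ?U) Q"
  \<comment> \<open>The route is H_n to H_m x H_n to H_n x H_m to H_m. The swap preserves the sum
    metric, and the two outer maps cost a factor 4 each.\<close>
  define F where "F = P \<circ> prod.swap \<circ> R"
  have R: "bij_betw R ?U (?V \<times> ?U)" unfolding R_def by (rule bij_betw_inv_into[OF Q])
  have "bij_betw prod.swap (?V \<times> ?U) (?U \<times> ?V)"
    by (simp add: bij_betw_def product_swap)
  then have F: "bij_betw F ?U ?V"
    unfolding F_def using R P by (metis bij_betw_trans comp_assoc)
  have dist: "hdist x y \<le> 16 * hdist (F x) (F y) \<and> hdist (F x) (F y) \<le> 16 * hdist x y"
    if xy: "x \<in> ?U" "y \<in> ?U" for x y
  proof -
    have "R x \<in> ?V \<times> ?U" "R y \<in> ?V \<times> ?U" using bij_betwE[OF R] xy by blast+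
    then obtain v u v' u' where *: "R x = (v, u)" "R y = (v', u')"
      and c: "v \<in> ?V" "u \<in> ?U" "v' \<in> ?V" "u' \<in> ?U"
      by (elim SigmaE) blast
    have Qxy: "Q (v, u) = x" "Q (v', u') = y"
      using bij_betw_inv_into_right[OF Q xy(1)] bij_betw_inv_into_right[OF Q xy(2)] *
      by (simp_all add: R_def)
    have Fxy: "F x = P (u, v)" "F y = P (u', v')" by (simp_all add: F_def *)
    show ?thesis
      using Pd[OF c(2,4,1,3)] Qd[OF c(1,3,2,4)] unfolding Qxy Fxy by auto
  qed
  have "1 / 16 * mdist (hamming_space n) x y \<le> mdist (hamming_space m) (F x) (F y) \<and>
      mdist (hamming_space m) (F x) (F y) \<le> 16 * mdist (hamming_space n) x y"
    if "x \<in> ?U" "y \<in> ?U" for x y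
  proof -
    have "F x \<in> ?V" "F y \<in> ?V" using that bij_betwE[OF F] by blast+
    then have "mdist (hamming_space m) (F x) (F y) = real (hdist (F x) (F y))"
      by (simp add: mdist_hamming_space hdist_def)
    moreover have "mdist (hamming_space n) x y = real (hdist x y)"
      using that by (simp add: mdist_hamming_space hdist_def)
    ultimately show ?thesis using dist[OF that] by linarith
  qed
  then show ?thesis
    unfolding bilipschitz_equivalent_def mspace_hamming_space using F by blast
qed

end
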